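(* Let $0<d^-\leqslant d^+$ be fixed, let $d_j$ satisfy $0<d^-\leqslant d_j\leqslant d^+$, let $\hat f(j)\in\mathbb C$ with $|\hat f(j)|\leqslant1$, and define $p_m$, $M_m$ by $\sum_mp_mz^m=\exp\{\sum_{j\geqslant1}d_jz^j/j\}$ and $\sum_mM_mz^m=\exp\{\sum_{j\geqslant1}d_j\hat f(j)z^j/j\}$. For $u>0$ let $$E(u)=\exp\Big\{2\sum_{\substack{1\leqslant k\leqslant n\\|\hat f(k)-1|>u}}\frac{|\hat f(k)-1|}{k}\Big\},\qquad L_n(1)=\sum_{j=1}^nd_j\frac{\hat f(j)-1}{j}.$$ Then there exists a constant $\eta=\eta(d^-,d^+)>0$ such that for every $0<u\leqslant\eta$, $$\Big|\frac{M_n}{p_n}\Big|\ll|\exp\{L_n(1)\}|\,E(u)^{d^+},$$ with the implied constant depending only on $d^-,d^+$. *)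

theory Defs
  imports
    "HOL-Analysis.Analysis"
    "HOL-Computational_Algebra.Formal_Power_Series"
begin

(* The formal power series exp (\<Sum>j\<ge>1. a j * z^j / j).  The value a 0 plays no role: the
   inner series has constant term 0, which is what makes the composition with oo meaningful. *)
definition exp_log_fps :: "(nat \<Rightarrow> 'a::field_char_0) \<Rightarrow> 'a fps" where
  "exp_log_fps a = fps_exp 1 oo Abs_fps (\<lambda>j. if j = 0 then 0 else a j / of_nat j)"

definition p_coeff :: "(nat \<Rightarrow> real) \<Rightarrow> nat \<Rightarrow> real" where
  "p_coeff d m = fps_nth (exp_log_fps d) m"

definition M_coeff :: "(nat \<Rightarrow> real) \<Rightarrow> (nat \<Rightarrow> complex) \<Rightarrow> nat \<Rightarrow> complex" where
  "M_coeff d f m = fps_nth (exp_log_fps (\<lambda>j. complex_of_real (d j) * f j)) m"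

definition E_fun :: "(nat \<Rightarrow> complex) \<Rightarrow> nat \<Rightarrow> real \<Rightarrow> real" where
  "E_fun f n u = exp (2 * (\<Sum>k | 1 \<le> k \<and> k \<le> n \<and> norm (f k - 1) > u. norm (f k - 1) / real k))"

definition L_one :: "(nat \<Rightarrow> real) \<Rightarrow> (nat \<Rightarrow> complex) \<Rightarrow> nat \<Rightarrow> complex" where
  "L_one d f n = (\<Sum>j=1..n. complex_of_real (d j) * ((f j - 1) / of_nat j))"

end

theory Submission
  imports Defs "HOL-Complex_Analysis.Complex_Analysis"
begin

text \<open>
  Write \<open>a j = d j * f j\<close> and let \<open>M\<^sub>N(z) = exp (\<Sum>j=1..N. a j * z ^ j / j)\<close>, an entire
  function whose first \<open>N + 1\<close> coefficients are \<open>M_coeff d f\<close>. The recurrence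
  \<open>m * M m = (\<Sum>j=1..m. a j * M (m - j))\<close> says \<open>z * M\<^sub>N'(z) = M\<^sub>N(z) * (\<Sum>j=1..N. a j * z ^ j)\<close>, so
  Parseval's identity bounds \<open>\<Sum>m\<le>N. (m * norm (M m))\<^sup>2\<close> by \<open>dp\<^sup>2 * N * (sup norm M\<^sub>N)\<^sup>2\<close>, the
  supremum being over the unit circle. By Cauchy-Schwarz \<open>\<Sum>m=N/2..N. norm (M m)\<close> is then at
  most a constant times this supremum.

  On the unit circle \<open>Re (f j * z ^ j) \<le> Re (f j) - (1 - Re (z ^ j)) + norm (f j - 1) * norm (z ^ j - 1)\<close>.
  Where \<open>norm (f j - 1) > u\<close> the last term is paid for by \<open>E_fun\<close>; elsewhere it is at most
  \<open>u * norm (z ^ j - 1)\<close>, and for small \<open>u\<close> the sum of these minus \<open>1 - Re (z ^ j)\<close>, with weights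
  \<open>d j / j\<close>, is bounded uniformly in \<open>N\<close> and \<open>z\<close>. Hence for \<open>N \<le> n\<close> the supremum of \<open>norm M\<^sub>N\<close> is
  at most a constant times \<open>(N / n) powr (dm / 2) * B\<close>, where
  \<open>B = exp (\<Sum>j=1..n. d j / j) * norm (exp (L_one d f n)) * E_fun f n u powr dp\<close>. The dyadic blocks
  thus form a geometric series, so \<open>n * norm (M n) \<le> dp * (\<Sum>m<n. norm (M m))\<close> is at most a constant
  times \<open>B\<close>. Finally \<open>n * p n\<close> is at least a constant times \<open>exp (\<Sum>j=1..n. d j / j)\<close>, by Markov's
  inequality for the coefficients of the truncation \<open>exp (\<Sum>j=1..N. d j * z ^ j / j)\<close> with \<open>N\<close> a
  small multiple of \<open>n\<close>.
\<close>

section \<open>The coefficient recurrence and its consequences\<close>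

lemma exp_log_fps_nth_0 [simp]: "fps_nth (exp_log_fps a) 0 = 1"
  by (simp add: exp_log_fps_def)

text \<open>Differentiating \<open>F = exp g\<close> gives \<open>z * F' = (z * g') * F\<close>;
  compare coefficients of \<open>z ^ m\<close>. The recurrence determines every coefficient from the
  zeroth one, so it drives the inductions that follow.\<close>

lemma exp_log_fps_recurrence:
  fixes a :: "nat \<Rightarrow> 'a::field_char_0"
  shows "of_nat m * fps_nth (exp_log_fps a) m
           = (\<Sum>j=1..m. a j * fps_nth (exp_log_fps a) (m - j))"
proof -
  define g :: "'a fps" where "g = Abs_fps (\<lambda>j. if j = 0 then 0 else a j / of_nat j)"
  define F where "F = exp_log_fps a"
  have F: "F = fps_exp 1 oo g" by (simp add: F_def g_def exp_log_fps_def)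
  have "fps_deriv F = F * fps_deriv g"
    unfolding F by (subst fps_compose_deriv) (simp_all add: g_def)
  hence "fps_X * fps_deriv F = (fps_X * fps_deriv g) * F"
    by (simp add: algebra_simps)
  moreover have "fps_nth (fps_X * fps_deriv F) m = of_nat m * fps_nth F m"
    by (cases m) auto
  moreover have "fps_X * fps_deriv g = Abs_fps (\<lambda>j. if j = 0 then 0 else a j)"
    by (rule fps_ext) (auto simp: g_def simp del: of_nat_Suc)
  ultimately have "of_nat m * fps_nth F m
      = (\<Sum>j=0..m. (if j = 0 then 0 else a j) * fps_nth F (m - j))"
    by (simp add: fps_mult_nth)
  also have "\<dots> = (\<Sum>j=1..m. a j * fps_nth F (m - j))"
    by (intro sum.mono_neutral_cong_right) auto
  finally show ?thesis by (simp add: F_def)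
qed

text \<open>The recurrence reaches only \<open>a 1\<close>, ..., \<open>a m\<close>. Hence cutting
  the exponent off after \<open>N\<close> yields an entire function with the same coefficients up to
  \<open>N\<close>.\<close>

lemma exp_log_fps_nth_cong:
  fixes a b :: "nat \<Rightarrow> 'a::field_char_0"
  assumes "\<And>j. 1 \<le> j \<Longrightarrow> j \<le> m \<Longrightarrow> a j = b j"
  shows "fps_nth (exp_log_fps a) m = fps_nth (exp_log_fps b) m"
  using assms
proof (induction m rule: less_induct)
  case (less m)
  show ?case
  proof (cases "m = 0")
    case False
    have "of_nat m * fps_nth (exp_log_fps a) m = of_nat m * fps_nth (exp_log_fps b) m"
      unfolding exp_log_fps_recurrence by (intro sum.cong) (use less in auto)
    thus ?thesis using False by simp
  qed auto
qed

lemma exp_log_fps_of_real: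
  "fps_nth (exp_log_fps (\<lambda>j. complex_of_real (a j))) m = of_real (fps_nth (exp_log_fps a) m)"
proof (induction m rule: less_induct)
  case (less m)
  show ?case
  proof (cases "m = 0")
    case False
    have "of_nat m * fps_nth (exp_log_fps (\<lambda>j. complex_of_real (a j))) m
        = complex_of_real (of_nat m * fps_nth (exp_log_fps a) m)"
      unfolding exp_log_fps_recurrence of_real_sum
      by (intro sum.cong) (use less in auto)
    thus ?thesis using False by simp
  qed auto
qed

lemma exp_log_fps_nonneg:
  fixes a :: "nat \<Rightarrow> real"
  assumes "\<And>j. 1 \<le> j \<Longrightarrow> 0 \<le> a j"
  shows "0 \<le> fps_nth (exp_log_fps a) m"
proof (induction m rule: less_induct)
  case (less m)
  show ?case
  proof (cases "m = 0")
    case False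
    have "0 \<le> of_nat m * fps_nth (exp_log_fps a) m"
      unfolding exp_log_fps_recurrence by (intro sum_nonneg mult_nonneg_nonneg) (use less assms in auto)
    thus ?thesis using False by (simp add: zero_le_mult_iff)
  qed auto
qed

lemma exp_log_fps_mono:
  fixes a b :: "nat \<Rightarrow> real"
  assumes "\<And>j. 1 \<le> j \<Longrightarrow> 0 \<le> a j" "\<And>j. 1 \<le> j \<Longrightarrow> a j \<le> b j"
  shows "fps_nth (exp_log_fps a) m \<le> fps_nth (exp_log_fps b) m"
proof (induction m rule: less_induct)
  case (less m)
  show ?case
  proof (cases "m = 0")
    case False
    have "of_nat m * fps_nth (exp_log_fps a) m \<le> of_nat m * fps_nth (exp_log_fps b) m"
      unfolding exp_log_fps_recurrence 
      by (intro sum_mono mult_mono) (use less assms order.trans[OF assms] exp_log_fps_nonneg[OF assms(1)] in auto)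
    thus ?thesis using False by simp
  qed auto
qed

lemma exp_log_fps_polynomial_expansion:
  fixes a :: "nat \<Rightarrow> complex"
  assumes "\<And>j. j > N \<Longrightarrow> a j = 0"
  shows "(\<lambda>z. exp (\<Sum>j=1..N. a j / of_nat j * z ^ j)) has_fps_expansion exp_log_fps a"
proof -
  define g where "g = (\<lambda>z. \<Sum>j=1..N. a j / of_nat j * z ^ j)"
  have "g has_fps_expansion (\<Sum>j=1..N. fps_const (a j / of_nat j) * fps_X ^ j)"
    unfolding g_def by (intro fps_expansion_intros)
  also have "(\<Sum>j=1..N. fps_const (a j / of_nat j) * fps_X ^ j)
      = Abs_fps (\<lambda>j. if j = 0 then 0 else a j / of_nat j)"
    by (rule fps_ext) (use assms in \<open>auto simp: fps_sum_nth sum.delta' if_distrib not_le cong: if_cong\<close>)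
  finally have "(exp \<circ> g) has_fps_expansion exp_log_fps a"
    unfolding exp_log_fps_def by (intro has_fps_expansion_compose has_fps_expansion_exp1) auto
  thus ?thesis by (simp add: o_def g_def)
qed

text \<open>The exponential of a polynomial is entire, so its expansion converges to it everywhere;
  at \<open>z = 1\<close> this gives the total mass in the lower bound for
  \<open>p_coeff\<close>.\<close>

lemma exp_log_fps_polynomial_sums:
  fixes a :: "nat \<Rightarrow> complex"
  assumes "\<And>j. j > N \<Longrightarrow> a j = 0"
  shows "(\<lambda>m. fps_nth (exp_log_fps a) m * z ^ m) sums exp (\<Sum>j=1..N. a j / of_nat j * z ^ j)"
  by (rule has_fps_expansion_imp_sums_complex
        [OF exp_log_fps_polynomial_expansion[OF assms], where r = \<infinity>])
     (auto intro!: holomorphic_intros)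

section \<open>Parseval's identity on the unit circle\<close>

lemma sum_root_of_unity_power:
  fixes z :: complex
  assumes "z ^ R = 1"
  shows "(\<Sum>k<R. z ^ k) = (if z = 1 then of_nat R else 0)"
  using assms by (auto simp: geometric_sum)

text \<open>Orthogonality of the \<open>R\<close>-th roots of unity: since \<open>T < R\<close>,
  distinct exponents up to \<open>T\<close> give distinct roots, so only the diagonal terms
  survive.\<close>

lemma discrete_parseval:
  fixes c :: "nat \<Rightarrow> complex"
  assumes "T < R"
  defines "w \<equiv> \<lambda>k. exp (2 * of_real pi * \<i> * of_nat k / of_nat R)"
  shows "(\<Sum>k<R. (norm (\<Sum>m\<le>T. c m * w k ^ m))\<^sup>2) = real R * (\<Sum>m\<le>T. (norm (c m))\<^sup>2)"
proof -
  \<comment> \<open>Exchanging base and exponent makes the sum over \<open>k\<close> geometric with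
    ratio \<open>w m * cnj (w l)\<close>.\<close>
  have wk: "w k ^ m = w m ^ k" for k m
    by (simp add: w_def exp_of_nat_mult [symmetric] algebra_simps)
  have nw: "norm (w m) = 1" for m
    by (simp add: w_def)
  have ww: "w m * cnj (w m) = 1" for m
    using nw[of m] by (simp add: complex_norm_square[symmetric])
  have q: "w m * cnj (w l) = 1 \<longleftrightarrow> m = l" if "m \<le> T" "l \<le> T" for m l
  proof
    assume "w m * cnj (w l) = 1"
    hence "w m * (w l * cnj (w l)) = w l" by (metis mult.left_commute mult.right_neutral)
    hence "w m = w l" by (simp add: ww)
    hence "m mod R = l mod R" unfolding w_def by (subst (asm) complex_root_unity_eq) (use assms in auto)
    thus "m = l" using that assms by auto
  qed (simp add: ww)
  have qR: "(w m * cnj (w l)) ^ R = 1" for m l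
    using complex_root_unity[of R] assms by (simp add: power_mult_distrib w_def flip: complex_cnj_power)
  have "(\<Sum>m\<le>T. c m * w k ^ m) = (\<Sum>m\<le>T. c m * w m ^ k)" for k
    by (simp only: wk[of k])
  hence "complex_of_real (\<Sum>k<R. (norm (\<Sum>m\<le>T. c m * w k ^ m))\<^sup>2)
      = complex_of_real (\<Sum>k<R. (norm (\<Sum>m\<le>T. c m * w m ^ k))\<^sup>2)"
    by simp
  also have "\<dots> = (\<Sum>k<R. \<Sum>m\<le>T. \<Sum>l\<le>T. c m * cnj (c l) * (w m * cnj (w l)) ^ k)"
    unfolding of_real_sum complex_norm_square
    by (intro sum.cong refl) (simp add: sum_product power_mult_distrib mult_ac)
  also have "\<dots> = (\<Sum>m\<le>T. \<Sum>l\<le>T. c m * cnj (c l) * (\<Sum>k<R. (w m * cnj (w l)) ^ k))"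
    by (subst sum.swap) (simp add: sum_distrib_left sum.swap[of _ _ "{..<R}"])
  also have "\<dots> = (\<Sum>m\<le>T. \<Sum>l\<le>T. if m = l then of_nat R * complex_of_real ((norm (c m))\<^sup>2) else 0)"
    by (intro sum.cong refl)
       (auto simp: sum_root_of_unity_power[OF qR] q complex_norm_square simp del: of_real_power)
  also have "\<dots> = complex_of_real (real R * (\<Sum>m\<le>T. (norm (c m))\<^sup>2))"
    by (simp add: sum.delta' sum_distrib_left)
  finally show ?thesis by (simp only: of_real_eq_iff)
qed

text \<open>Truncate the series at \<open>T\<close>, apply the finite identity at
  \<open>T + 1\<close> roots of unity, and let the tail \<open>\<tau> T\<close> tend to 0. Keeping
  the polynomial in the pointwise bound lets its mean square enter rather than its supremum.\<close>

lemma mean_square_le_of_bound_on_circle: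
  fixes g l :: "nat \<Rightarrow> complex" and G :: "complex \<Rightarrow> complex"
  assumes summ: "summable (\<lambda>m. norm (g m))"
    and G: "\<And>z. norm z = 1 \<Longrightarrow> (\<lambda>m. g m * z ^ m) sums G z"
    and bound: "\<And>z. norm z = 1 \<Longrightarrow> norm (G z) \<le> Q * norm (\<Sum>j\<le>N. l j * z ^ j)"
    and Q: "0 \<le> Q"
  shows "(\<Sum>m\<le>N. (norm (g m))\<^sup>2) \<le> Q\<^sup>2 * (\<Sum>j\<le>N. (norm (l j))\<^sup>2)"
proof -
  define B where "B = (\<Sum>j\<le>N. norm (l j))"
  define \<tau> where "\<tau> = (\<lambda>T. \<Sum>m. norm (g (m + Suc T)))"
  have \<tau>: "\<tau> \<longlonglongrightarrow> 0"
  proof -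
    have "(\<lambda>T. (\<Sum>m. norm (g m)) - (\<Sum>m<T. norm (g m))) \<longlonglongrightarrow> 0"
      by (rule tendsto_eq_intros summable_LIMSEQ[OF summ] refl | simp)+
    hence "(\<lambda>T. \<Sum>m. norm (g (m + T))) \<longlonglongrightarrow> 0"
      by (simp add: suminf_minus_initial_segment[OF summ])
    thus ?thesis unfolding \<tau>_def by (rule LIMSEQ_Suc)
  qed
  \<comment> \<open>With \<open>T \<ge> N\<close> both polynomials have degree below
    \<open>R = Suc T\<close>, so the same sampling points serve for both. The crude bound
    \<open>B\<close> is used only in the cross term, which vanishes in the limit.\<close>
  have key: "(\<Sum>m\<le>N. (norm (g m))\<^sup>2) \<le> Q\<^sup>2 * (\<Sum>j\<le>N. (norm (l j))\<^sup>2) + (2 * Q * B * \<tau> T + (\<tau> T)\<^sup>2)"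
    if "T \<ge> N" for T
  proof -
    define R where "R = Suc T"
    define w where "w = (\<lambda>k. exp (2 * of_real pi * \<i> * of_nat k / of_nat R :: complex))"
    have nw: "norm (w k) = 1" for k by (simp add: w_def)
    have sm: "summable (\<lambda>m. norm (g (m + Suc T)))" by (subst summable_iff_shift) (rule summ)
    have tail: "norm (\<Sum>m\<le>T. g m * z ^ m) \<le> Q * norm (\<Sum>j\<le>N. l j * z ^ j) + \<tau> T"
      if z: "norm z = 1" for z
    proof -
      have "(\<lambda>m. g (m + Suc T) * z ^ (m + Suc T)) sums (G z - (\<Sum>m<Suc T. g m * z ^ m))"
        by (intro sums_split_initial_segment G z)
      hence "G z - (\<Sum>m\<le>T. g m * z ^ m) = (\<Sum>m. g (m + Suc T) * z ^ (m + Suc T))"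
        by (simp only: sums_iff lessThan_Suc_atMost)
      also have "norm \<dots> \<le> \<tau> T"
        unfolding \<tau>_def by (rule order.trans[OF summable_norm])
          (use sm z in \<open>simp_all add: norm_mult norm_power\<close>)
      finally have "norm (G z - (\<Sum>m\<le>T. g m * z ^ m)) \<le> \<tau> T" .
      moreover have "norm (\<Sum>m\<le>T. g m * z ^ m) \<le> norm (G z) + norm (G z - (\<Sum>m\<le>T. g m * z ^ m))"
        using norm_triangle_sub[of "\<Sum>m\<le>T. g m * z ^ m" "G z"] by (simp add: norm_minus_commute)
      ultimately show ?thesis using bound[OF z] by linarith
    qed
    have \<tau>0: "\<tau> T \<ge> 0" unfolding \<tau>_def
      by (rule suminf_nonneg[OF sm]) simp
    have lB: "norm (\<Sum>j\<le>N. l j * z ^ j) \<le> B" if "norm z = 1" for z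
      unfolding B_def by (rule order.trans[OF norm_sum]) (simp add: norm_mult norm_power that)
    have "real R * (\<Sum>m\<le>N. (norm (g m))\<^sup>2) \<le> real R * (\<Sum>m\<le>T. (norm (g m))\<^sup>2)"
      by (intro mult_left_mono sum_mono2) (use that in auto)
    also have "\<dots> = (\<Sum>k<R. (norm (\<Sum>m\<le>T. g m * w k ^ m))\<^sup>2)"
      unfolding w_def by (rule discrete_parseval [symmetric]) (simp add: R_def)
    also have "\<dots> \<le> (\<Sum>k<R. Q\<^sup>2 * (norm (\<Sum>j\<le>N. l j * w k ^ j))\<^sup>2 + (2 * Q * B * \<tau> T + (\<tau> T)\<^sup>2))"
    proof (rule sum_mono)
      fix k
      have "(norm (\<Sum>m\<le>T. g m * w k ^ m))\<^sup>2 \<le> (Q * norm (\<Sum>j\<le>N. l j * w k ^ j) + \<tau> T)\<^sup>2"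
        by (intro power_mono tail nw) auto
      also have "\<dots> = Q\<^sup>2 * (norm (\<Sum>j\<le>N. l j * w k ^ j))\<^sup>2
          + (2 * Q * norm (\<Sum>j\<le>N. l j * w k ^ j) * \<tau> T + (\<tau> T)\<^sup>2)"
        by (simp add: power2_eq_square algebra_simps)
      also have "\<dots> \<le> Q\<^sup>2 * (norm (\<Sum>j\<le>N. l j * w k ^ j))\<^sup>2 + (2 * Q * B * \<tau> T + (\<tau> T)\<^sup>2)"
        by (intro add_mono mult_right_mono mult_left_mono lB nw order.refl) (use Q \<tau>0 in auto)
      finally show "(norm (\<Sum>m\<le>T. g m * w k ^ m))\<^sup>2 \<le> \<dots>" .
    qed
    also have "\<dots> = Q\<^sup>2 * (\<Sum>k<R. (norm (\<Sum>j\<le>N. l j * w k ^ j))\<^sup>2) + real R * (2 * Q * B * \<tau> T + (\<tau> T)\<^sup>2)"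
      by (simp add: sum.distrib sum_distrib_left algebra_simps)
    also have "(\<Sum>k<R. (norm (\<Sum>j\<le>N. l j * w k ^ j))\<^sup>2) = real R * (\<Sum>j\<le>N. (norm (l j))\<^sup>2)"
      unfolding w_def by (rule discrete_parseval) (use that in \<open>simp add: R_def\<close>)
    finally have "real R * (\<Sum>m\<le>N. (norm (g m))\<^sup>2)
        \<le> real R * (Q\<^sup>2 * (\<Sum>j\<le>N. (norm (l j))\<^sup>2) + (2 * Q * B * \<tau> T + (\<tau> T)\<^sup>2))"
      by (simp add: algebra_simps)
    thus ?thesis by (simp add: R_def)
  qed
  have "(\<lambda>T. Q\<^sup>2 * (\<Sum>j\<le>N. (norm (l j))\<^sup>2) + (2 * Q * B * \<tau> T + (\<tau> T)\<^sup>2))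
      \<longlonglongrightarrow> Q\<^sup>2 * (\<Sum>j\<le>N. (norm (l j))\<^sup>2)"
    by (rule tendsto_eq_intros \<tau> refl | simp)+
  thus ?thesis
    by (rule LIMSEQ_le_const) (use key in blast)
qed

section \<open>Estimates for sums with weights \<open>1 / j\<close>\<close>

lemma norm_sum_power_div_le:
  fixes z :: complex
  assumes z: "norm z = 1" and a: "1 \<le> a"
  shows "norm (1 - z) * norm (\<Sum>j=a..<a+k. z ^ j / of_nat j) \<le> 2 / real a"
proof -
  define S where "S = (\<lambda>k. \<Sum>j=a..<a+k. z ^ j / of_nat j)"
  \<comment> \<open>Summation by parts as an induction: adding the boundary term
    \<open>z ^ b / b\<close> leaves increments of norm \<open>1 / b - 1 / (b + 1)\<close>, which
    telescope.\<close>
  have *: "norm ((1 - z) * S k + z ^ (a + k) / of_nat (a + k)) \<le> 2 / real a - 1 / real (a + k)" for k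
  proof (induction k)
    case 0
    show ?case using z a by (simp add: S_def norm_divide norm_power)
  next
    case (Suc k)
    define b where "b = a + k"
    have b: "b > 0" using a by (simp add: b_def)
    have S_Suc: "S (Suc k) = S k + z ^ b / of_nat b"
      by (simp add: S_def b_def)
    have "(1 - z) * S (Suc k) + z ^ Suc b / of_nat (Suc b)
        = ((1 - z) * S k + z ^ b / of_nat b) - z ^ Suc b * of_real (1 / real b - 1 / real (Suc b))"
      by (simp add: S_Suc algebra_simps diff_divide_distrib)
    also have "norm \<dots> \<le> (2 / real a - 1 / real b) + norm (z ^ Suc b * of_real (1 / real b - 1 / real (Suc b)))"
      by (rule order.trans[OF norm_triangle_ineq4]) (use Suc b_def in auto)
    also have "norm (z ^ Suc b * of_real (1 / real b - 1 / real (Suc b))) = 1 / real b - 1 / real (Suc b)"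
      using b by (simp only: norm_mult norm_power z norm_of_real) (simp add: field_simps)
    finally show ?case by (simp add: b_def)
  qed
  have "norm ((1 - z) * S k) \<le> norm ((1 - z) * S k + z ^ (a + k) / of_nat (a + k)) + norm (z ^ (a + k) / of_nat (a + k) :: complex)"
    using norm_triangle_ineq4[of "(1 - z) * S k + z ^ (a + k) / of_nat (a + k)" "z ^ (a + k) / of_nat (a + k)"]
    by simp
  also have "norm (z ^ (a + k) / of_nat (a + k) :: complex) = 1 / real (a + k)"
    by (simp only: norm_divide norm_power z norm_of_nat) simp
  finally show ?thesis using *[of k] by (simp add: norm_mult S_def)
qed

text \<open>
  On the terms with \<open>j < 1 / norm (1 - z)\<close> the linear contribution is at most \<open>dp * u\<close> in total. On the
  remaining ones it is absorbed by the constant part of \<open>1 - Re (z ^ j)\<close>, while the oscillating part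
  is summed by parts.
\<close>
lemma sum_distance_minus_defect_le:
  fixes z :: complex and d :: "nat \<Rightarrow> real"
  assumes z: "norm z = 1" and d: "\<And>j. 1 \<le> j \<Longrightarrow> dm \<le> d j \<and> d j \<le> dp"
    and dm: "0 < dm" and u: "0 \<le> u" "2 * u * dp \<le> dm"
  shows "(\<Sum>j=1..N. d j * (u * norm (z ^ j - 1) - (1 - Re (z ^ j))) / real j) \<le> 3 * dm"
proof (cases "z = 1")
  case True
  thus ?thesis using dm by simp
next
  case False
  define t where "t = norm (1 - z)"
  have t: "t > 0" using False by (simp add: t_def)
  \<comment> \<open>The least integer above \<open>1 / t\<close>: \<open>(a - 1) * t \<le> 1\<close>
    controls the initial range, and \<open>a * t \<ge> 1\<close> turns the bound
    \<open>2 / (a * t)\<close> for the oscillating sum into 2.\<close>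
  define a where "a = nat \<lfloor>1 / t\<rfloor> + 1"
  have a1: "real (a - 1) * t \<le> 1"
    using t by (simp add: a_def pos_le_divide_eq [symmetric])
  have a2: "real a * t \<ge> 1"
  proof -
    have "1 / t \<le> real a" unfolding a_def using t by linarith
    thus ?thesis using t by (simp add: field_simps)
  qed
  have dp: "0 < dp" using d[of 1] dm by auto
  have Re1: "Re (z ^ j) \<le> 1" for j
    using complex_Re_le_cmod[of "z ^ j"] z by (simp add: norm_power)
  have bnd: "d j * (u * norm (z ^ j - 1) - (1 - Re (z ^ j))) / real j
      \<le> (if j < a then dp * u * t else dm * (Re (z ^ j) / real j))" if j: "j \<in> {1..N}" for j
  proof (cases "j < a")
    case True
    have "d j * (u * norm (z ^ j - 1) - (1 - Re (z ^ j))) \<le> d j * (u * norm (z ^ j - 1))"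
      using d[of j] j dm Re1[of j] by (intro mult_left_mono) auto
    also have "\<dots> \<le> dp * (u * (real j * t))"
    proof (intro mult_mono)
      have "norm (z ^ j - 1) \<le> real j * norm (z - 1)"
        using norm_power_diff[of z 1 j] z by simp
      thus "norm (z ^ j - 1) \<le> real j * t" by (simp add: t_def norm_minus_commute)
    qed (use d[of j] j dm u dp t in auto)
    finally show ?thesis using True j by (simp add: field_simps)
  next
    case F: False
    \<comment> \<open>The trivial bound 2 is the source of the condition
      \<open>2 * u * dp \<le> dm\<close>: the linear term is then at most the constant
      \<open>dm\<close> in \<open>dm * (1 - Re (z ^ j))\<close>.\<close>
    have "norm (z ^ j - 1) \<le> 2"
      using norm_triangle_ineq4[of "z ^ j" 1] z by (simp add: norm_power)
    hence "d j * (u * norm (z ^ j - 1)) \<le> dp * (u * 2)"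
      using d[of j] j dm u dp by (intro mult_mono) auto
    moreover have "dm * (1 - Re (z ^ j)) \<le> d j * (1 - Re (z ^ j))"
      using d[of j] j Re1[of j] by (intro mult_right_mono) auto
    ultimately have "d j * (u * norm (z ^ j - 1) - (1 - Re (z ^ j))) \<le> dm * Re (z ^ j)"
      using u by (simp add: algebra_simps)
    thus ?thesis using F j by (simp add: divide_right_mono)
  qed
  have "(\<Sum>j=1..N. d j * (u * norm (z ^ j - 1) - (1 - Re (z ^ j))) / real j)
      \<le> (\<Sum>j=1..N. if j < a then dp * u * t else dm * (Re (z ^ j) / real j))"
    by (intro sum_mono bnd)
  also have "\<dots> = (\<Sum>j\<in>{j\<in>{1..N}. j < a}. dp * u * t)
      + (\<Sum>j\<in>{j\<in>{1..N}. \<not> j < a}. dm * (Re (z ^ j) / real j))"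
    by (simp add: sum.If_cases Int_def Collect_neg_eq [symmetric])
  \<comment> \<open>Truncated subtraction makes this interval empty when
    \<open>a > N\<close>.\<close>
  also have "{j\<in>{1..N}. \<not> j < a} = {a..<a + (Suc N - a)}"
    by (auto simp: a_def)
  also have "(\<Sum>j\<in>\<dots>. dm * (Re (z ^ j) / real j)) = dm * Re (\<Sum>j=a..<a + (Suc N - a). z ^ j / of_nat j)"
    by (simp add: sum_distrib_left Re_divide_of_nat)
  also have "\<dots> \<le> dm * 2"
  proof (intro mult_left_mono)
    define S where "S = (\<Sum>j=a..<a + (Suc N - a). z ^ j / of_nat j)"
    have a0: "real a > 0" by (simp add: a_def)
    have "t * norm S \<le> 2 / real a"
      unfolding S_def t_def by (rule norm_sum_power_div_le[OF z]) (simp add: a_def)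
    hence "(real a * t) * norm S \<le> 2" using a0 by (simp add: field_simps)
    moreover have "1 * norm S \<le> (real a * t) * norm S"
      by (intro mult_right_mono a2) auto
    ultimately show "Re S \<le> 2" using complex_Re_le_cmod[of S] by linarith
  qed (use dm in auto)
  also have "(\<Sum>j\<in>{j\<in>{1..N}. j < a}. dp * u * t) \<le> dm"
  proof -
    have "card {j\<in>{1..N}. j < a} \<le> card {1..a - 1}"
      by (intro card_mono) auto
    hence "real (card {j\<in>{1..N}. j < a}) * t \<le> real (a - 1) * t"
      using t by (intro mult_right_mono) auto
    with a1 have "real (card {j\<in>{1..N}. j < a}) * t \<le> 1" by linarith
    hence "(dp * u) * (real (card {j\<in>{1..N}. j < a}) * t) \<le> (dp * u) * 1"
      using dp u by (intro mult_left_mono) auto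
    moreover have "2 * (dp * u) \<le> dm" "0 \<le> dp * u" using u dp by (simp_all add: mult_ac)
    hence "dp * u \<le> dm" by linarith
    ultimately show ?thesis by (simp add: mult_ac)
  qed
  finally show ?thesis by simp
qed

text \<open>Telescoping \<open>ln (1 + x) \<le> x\<close>. The shift by one inside the logarithms
  admits \<open>N = 0\<close>.\<close>

lemma ln_diff_le_sum_inverse:
  assumes "N \<le> n"
  shows "ln (real n + 1) - ln (real N + 1) \<le> (\<Sum>j=N+1..n. 1 / real j)"
  using assms
proof (induction n rule: dec_induct)
  case (step n)
  have "ln (real (Suc n) + 1) - ln (real n + 1) = ln (1 + 1 / real (Suc n))"
    using ln_div[of "real (Suc n) + 1" "real n + 1"] by (simp add: field_simps)
  also have "\<dots> \<le> 1 / real (Suc n)"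
    by (rule ln_add_one_self_le_self) auto
  finally show ?case using step by simp
qed auto

section \<open>From a bound on the circle to partial sums of coefficient norms\<close>

lemma exp_log_fps_weighted_mean_square:
  fixes a :: "nat \<Rightarrow> complex"
  assumes Q: "0 \<le> Q" and bound: "\<And>z. norm z = 1 \<Longrightarrow> norm (exp (\<Sum>j=1..N. a j / of_nat j * z ^ j)) \<le> Q"
  shows "(\<Sum>m\<le>N. (real m * norm (fps_nth (exp_log_fps a) m))\<^sup>2) \<le> Q\<^sup>2 * (\<Sum>j=1..N. (norm (a j))\<^sup>2)"
proof -
  define b where "b = (\<lambda>j. if j \<le> N then a j else 0)"
  define l where "l = (\<lambda>j. if j = 0 then 0 else b j)"
  define F where "F = exp_log_fps b"
  \<comment> \<open>\<open>H\<close> is the series of \<open>z * F'\<close>, written as the product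
    whose factor \<open>F\<close> is bounded by \<open>Q\<close> on the circle.\<close>
  define H where "H = Abs_fps l * F"
  define P where "P = (\<lambda>z. \<Sum>j=1..N. a j / of_nat j * z ^ j)"
  define G where "G = (\<lambda>z. (\<Sum>j\<le>N. l j * z ^ j) * exp (P z))"
  have P: "P z = (\<Sum>j=1..N. b j / of_nat j * z ^ j)" for z
    by (simp add: P_def b_def)
  have exF: "(\<lambda>z. exp (P z)) has_fps_expansion F"
    unfolding P F_def by (rule exp_log_fps_polynomial_expansion) (simp add: b_def)
  have "(\<lambda>z. \<Sum>j\<le>N. l j * z ^ j) has_fps_expansion (\<Sum>j\<le>N. fps_const (l j) * fps_X ^ j)"
    by (intro fps_expansion_intros)
  also have "(\<Sum>j\<le>N. fps_const (l j) * fps_X ^ j) = Abs_fps l"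
    by (rule fps_ext) (auto simp: fps_sum_nth sum.delta' if_distrib l_def b_def cong: if_cong)
  finally have exH: "G has_fps_expansion H"
    unfolding G_def H_def by (intro has_fps_expansion_mult exF)
  have holo: "G holomorphic_on eball 0 \<infinity>"
    unfolding G_def P_def by (auto intro!: holomorphic_intros)
  have radius: "fps_conv_radius H = \<infinity>"
    using holomorphic_on_imp_fps_conv_radius_ge[OF exH holo] by simp
  have Hnth: "fps_nth H m = of_nat m * fps_nth F m" for m
  proof -
    have "fps_nth H m = (\<Sum>j=0..m. l j * fps_nth F (m - j))"
      by (simp add: H_def fps_mult_nth)
    also have "\<dots> = (\<Sum>j=1..m. b j * fps_nth F (m - j))"
      by (intro sum.mono_neutral_cong_right) (auto simp: l_def)
    finally show ?thesis by (simp add: F_def exp_log_fps_recurrence)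
  qed
  have "(\<Sum>m\<le>N. (norm (fps_nth H m))\<^sup>2) \<le> Q\<^sup>2 * (\<Sum>j\<le>N. (norm (l j))\<^sup>2)"
  proof (rule mean_square_le_of_bound_on_circle[where G = G])
    show "summable (\<lambda>m. norm (fps_nth H m))"
      using norm_summable_fps[of 1 H] by (simp add: radius)
    show "(\<lambda>m. fps_nth H m * z ^ m) sums G z" for z
      by (rule has_fps_expansion_imp_sums_complex[OF exH holo]) auto
    show "norm (G z) \<le> Q * norm (\<Sum>j\<le>N. l j * z ^ j)" if "norm z = 1" for z
      using mult_left_mono[OF bound[OF that], of "norm (\<Sum>j\<le>N. l j * z ^ j)"]
      by (simp add: G_def norm_mult P_def mult_ac)
  qed (rule Q)
  also have "(\<Sum>j\<le>N. (norm (l j))\<^sup>2) = (\<Sum>j=1..N. (norm (a j))\<^sup>2)"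
    by (intro sum.mono_neutral_cong_right) (auto simp: l_def b_def)
  also have "(\<Sum>m\<le>N. (norm (fps_nth H m))\<^sup>2) = (\<Sum>m\<le>N. (real m * norm (fps_nth (exp_log_fps a) m))\<^sup>2)"
  proof (intro sum.cong refl)
    fix m assume "m \<in> {..N}"
    hence "fps_nth F m = fps_nth (exp_log_fps a) m"
      unfolding F_def by (intro exp_log_fps_nth_cong) (simp add: b_def)
    thus "(norm (fps_nth H m))\<^sup>2 = (real m * norm (fps_nth (exp_log_fps a) m))\<^sup>2"
      by (simp add: Hnth norm_mult)
  qed
  finally show ?thesis .
qed

text \<open>Only the truncation at the block's own upper end \<open>N\<close> is bounded by
  \<open>Q\<close>, so different blocks may use different suprema.\<close>

lemma exp_log_fps_dyadic_block:
  fixes a :: "nat \<Rightarrow> complex"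
  assumes Q: "0 \<le> Q" and bound: "\<And>z. norm z = 1 \<Longrightarrow> norm (exp (\<Sum>j=1..N. a j / of_nat j * z ^ j)) \<le> Q"
    and a: "\<And>j. 1 \<le> j \<Longrightarrow> norm (a j) \<le> D" and D: "0 \<le> D" and N: "0 < N"
  shows "(\<Sum>m=N div 2 + 1..N. norm (fps_nth (exp_log_fps a) m)) \<le> 2 * D * Q"
proof (rule power2_le_imp_le)
  define M where "M = (\<lambda>m. norm (fps_nth (exp_log_fps a) m))"
  define A where "A = {N div 2 + 1..N}"
  have "(\<Sum>m\<in>A. M m)\<^sup>2 \<le> (\<Sum>m\<in>A. (M m)\<^sup>2) * real (card A)"
    using Cauchy_Schwarz_ineq_sum[of M "\<lambda>_. 1" A] by simp
  also have "\<dots> \<le> (\<Sum>m\<in>A. (2 / real N)\<^sup>2 * (real m * M m)\<^sup>2) * real N"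
  \<comment> \<open>On \<open>A\<close> one has \<open>m \<ge> N / 2\<close>, so the weight
    \<open>m\<close> is introduced at the cost of \<open>2 / N\<close>; \<open>A\<close> has at most
    \<open>N\<close> elements.\<close>
  proof (intro mult_mono sum_mono)
    fix m assume "m \<in> A"
    hence "real N \<le> 2 * real m" by (auto simp: A_def)
    hence "1 * M m \<le> (2 / real N * real m) * M m"
      using N by (intro mult_right_mono) (auto simp: field_simps M_def)
    hence "(M m)\<^sup>2 \<le> (2 / real N * (real m * M m))\<^sup>2"
      by (intro power_mono) (auto simp: M_def mult_ac)
    thus "(M m)\<^sup>2 \<le> (2 / real N)\<^sup>2 * (real m * M m)\<^sup>2" by (simp only: power_mult_distrib)
  qed (auto simp: A_def intro!: sum_nonneg)
  also have "\<dots> = 4 / real N * (\<Sum>m\<in>A. (real m * M m)\<^sup>2)"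
    unfolding sum_distrib_left [symmetric] using N by (simp add: power2_eq_square)
  also have "\<dots> \<le> 4 / real N * (\<Sum>m\<le>N. (real m * M m)\<^sup>2)"
    by (intro mult_left_mono sum_mono2) (auto simp: A_def)
  also have "\<dots> \<le> 4 / real N * (Q\<^sup>2 * (\<Sum>j=1..N. (norm (a j))\<^sup>2))"
    unfolding M_def by (intro mult_left_mono exp_log_fps_weighted_mean_square Q bound) auto
  also have "\<dots> \<le> 4 / real N * (Q\<^sup>2 * (\<Sum>j=1..N. D\<^sup>2))"
    by (intro mult_left_mono sum_mono power_mono a) auto
  also have "\<dots> = (2 * D * Q)\<^sup>2"
    using N by (simp add: field_simps power2_eq_square)
  finally show "(\<Sum>m=N div 2 + 1..N. norm (fps_nth (exp_log_fps a) m))\<^sup>2 \<le> (2 * D * Q)\<^sup>2"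
    by (simp add: A_def M_def)
qed (use D Q in auto)

lemma exp_log_fps_partial_norm_sum_le:
  fixes a :: "nat \<Rightarrow> complex"
  assumes bound: "\<And>N z. 1 \<le> N \<Longrightarrow> N \<le> n \<Longrightarrow> norm z = 1 \<Longrightarrow>
      norm (exp (\<Sum>j=1..N. a j / of_nat j * z ^ j)) \<le> Y * real N powr \<delta>"
    and Y: "0 \<le> Y" and \<delta>: "0 < \<delta>"
    and a: "\<And>j. 1 \<le> j \<Longrightarrow> norm (a j) \<le> D" and D: "0 \<le> D" and "N \<le> n"
  shows "(\<Sum>m=1..N. norm (fps_nth (exp_log_fps a) m)) \<le> 2 * D / (1 - 2 powr -\<delta>) * (Y * real N powr \<delta>)"
  using \<open>N \<le> n\<close>
proof (induction N rule: less_induct)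
  case (less N)
  define M where "M = (\<lambda>m. norm (fps_nth (exp_log_fps a) m))"
  define \<theta> where "\<theta> = 2 powr -\<delta>"
  define C where "C = 2 * D / (1 - \<theta>)"
  have \<theta>: "\<theta> < 1" "0 < \<theta>" using \<delta> by (auto simp: \<theta>_def powr_less_one)
  \<comment> \<open>\<open>C\<close> is the sum of the geometric series with first term
    \<open>2 * D\<close> and ratio \<open>\<theta>\<close>; this fixed-point equation closes the
    induction from \<open>N div 2\<close> to \<open>N\<close>.\<close>
  have C: "C * \<theta> + 2 * D = C" using \<theta> by (simp add: C_def field_simps)
  have C0: "0 \<le> C" using \<theta> D by (simp add: C_def)
  show ?case
  proof (cases "N = 0")
    case False
    have "{1..N} = {1..N div 2} \<union> {N div 2 + 1..N}" by auto
    hence "(\<Sum>m=1..N. M m) = (\<Sum>m=1..N div 2. M m) + (\<Sum>m=N div 2 + 1..N. M m)"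
      by (simp only:) (rule sum.union_disjoint, auto)
    also have "\<dots> \<le> C * (Y * real (N div 2) powr \<delta>) + 2 * D * (Y * real N powr \<delta>)"
      unfolding M_def C_def \<theta>_def
      by (intro add_mono less.IH exp_log_fps_dyadic_block bound a D) (use False less.prems Y in auto)
    also have "\<dots> \<le> C * (Y * (real N / 2) powr \<delta>) + 2 * D * (Y * real N powr \<delta>)"
      using \<delta> C0 Y by (intro add_right_mono mult_left_mono powr_mono2) auto
    also have "(real N / 2) powr \<delta> = \<theta> * real N powr \<delta>"
      by (simp add: powr_divide powr_minus \<theta>_def field_simps)
    also have "C * (Y * (\<theta> * real N powr \<delta>)) + 2 * D * (Y * real N powr \<delta>)
        = (C * \<theta> + 2 * D) * (Y * real N powr \<delta>)" by (simp add: algebra_simps)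
    finally show ?thesis unfolding C by (simp add: M_def C_def \<theta>_def)
  qed auto
qed

section \<open>The lower bound for \<open>p_coeff\<close>\<close>

lemma p_coeff_lower_bound:
  fixes d :: "nat \<Rightarrow> real"
  assumes d: "\<And>j. 1 \<le> j \<Longrightarrow> dm \<le> d j \<and> d j \<le> dp"
    and dm: "0 < dm" and n: "1 \<le> n" and K: "2 * dp \<le> real K"
  shows "dm / 2 * exp (- dp * real K) * exp (\<Sum>j=1..n. d j / real j) \<le> real n * p_coeff d n"
proof -
  have dp: "0 < dp" using d[of 1] dm by auto
  hence K0: "0 < K" using K by (cases "K = 0") auto
  \<comment> \<open>This choice gives \<open>K * N < n\<close>, so the coefficients carrying half
    the mass have index below \<open>n\<close>, while \<open>n - N \<le> K * (N + 1)\<close> keeps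
    the cut-off part of the exponent bounded, also for \<open>N = 0\<close>.\<close>
  define N where "N = (n - 1) div K"
  define b where "b = (\<lambda>j. if j \<le> N then d j else 0)"
  define q where "q = (\<lambda>m. fps_nth (exp_log_fps b) m)"
  define D where "D = exp (\<Sum>j=1..N. d j / real j)"
  have b0: "0 \<le> b j" "b j \<le> d j" if "1 \<le> j" for j using d[OF that] dm by (auto simp: b_def)
  have q0: "0 \<le> q m" for m unfolding q_def by (rule exp_log_fps_nonneg) (rule b0)
  have qp: "q m \<le> p_coeff d m" for m
    unfolding q_def p_coeff_def by (rule exp_log_fps_mono) (use b0 in auto)
  have b_le: "b j \<le> dp" if "1 \<le> j" for j
    using b0(2)[OF that] d[OF that] by linarith
  \<comment> \<open>The first moment of the masses \<open>q m\<close>: by the recurrence each of the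
    \<open>N\<close> values of \<open>j\<close> contributes at most \<open>dp\<close> times the
    mass.\<close>
  have moment: "(\<Sum>m\<le>T. real m * q m) \<le> dp * real N * (\<Sum>m\<le>T. q m)" for T
  proof -
    have "(\<Sum>m\<le>T. real m * q m) = (\<Sum>m\<le>T. \<Sum>j=1..m. b j * q (m - j))"
      unfolding q_def exp_log_fps_recurrence by simp
    also have "\<dots> \<le> (\<Sum>m\<le>T. \<Sum>j=1..N. dp * (if j \<le> m then q (m - j) else 0))"
    proof (rule sum_mono)
      fix m
      have "(\<Sum>j=1..m. b j * q (m - j)) = (\<Sum>j\<in>{1..m} \<inter> {1..N}. b j * q (m - j))"
        by (intro sum.mono_neutral_right) (auto simp: b_def)
      also have "\<dots> \<le> (\<Sum>j\<in>{1..m} \<inter> {1..N}. dp * q (m - j))"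
        by (intro sum_mono mult_right_mono q0) (use b_le in auto)
      also have "\<dots> = (\<Sum>j=1..N. dp * (if j \<le> m then q (m - j) else 0))"
        by (intro sum.mono_neutral_cong_left) auto
      finally show "(\<Sum>j=1..m. b j * q (m - j)) \<le> \<dots>" .
    qed
    also have "\<dots> = (\<Sum>j=1..N. dp * (\<Sum>m\<le>T. if j \<le> m then q (m - j) else 0))"
      by (subst sum.swap) (simp add: sum_distrib_left)
    also have "\<dots> \<le> (\<Sum>j=1..N. dp * (\<Sum>m\<le>T. q m))"
    proof (rule sum_mono, rule mult_left_mono)
      fix j
      have "(\<Sum>m\<le>T. if j \<le> m then q (m - j) else 0) = (\<Sum>m\<in>{j..T}. q (m - j))"
        by (intro sum.mono_neutral_cong_right) auto
      also have "\<dots> = (\<Sum>i\<in>(\<lambda>m. m - j) ` {j..T}. q i)"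
        by (subst sum.reindex) (auto simp: inj_on_def)
      also have "\<dots> \<le> (\<Sum>m\<le>T. q m)"
        by (intro sum_mono2 q0) auto
      finally show "(\<Sum>m\<le>T. if j \<le> m then q (m - j) else 0) \<le> (\<Sum>m\<le>T. q m)" .
    qed (use dp in auto)
    finally show ?thesis by (simp add: mult_ac)
  qed
  \<comment> \<open>Markov's inequality: beyond \<open>K * N\<close> every index is at least
    \<open>K * N + 1\<close>, which exceeds twice the mean bound \<open>dp * N\<close> because
    \<open>2 * dp \<le> K\<close>.\<close>
  have half: "(\<Sum>m\<le>T. q m) \<le> 2 * (\<Sum>m\<le>K * N. q m)" if T: "K * N \<le> T" for T
  proof -
    define R where "R = (\<Sum>m\<in>{K * N<..T}. q m)"
    have R0: "0 \<le> R" unfolding R_def by (intro sum_nonneg q0)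
    have "{..T} = {..K * N} \<union> {K * N<..T}" using T by auto
    hence split: "(\<Sum>m\<le>T. q m) = (\<Sum>m\<le>K * N. q m) + R"
      unfolding R_def by (simp only:) (rule sum.union_disjoint, auto)
    have "real (K * N + 1) * R = (\<Sum>m\<in>{K * N<..T}. real (K * N + 1) * q m)"
      by (simp only: R_def sum_distrib_left)
    also have "\<dots> \<le> (\<Sum>m\<in>{K * N<..T}. real m * q m)"
      by (intro sum_mono mult_right_mono q0 of_nat_mono) auto
    also have "\<dots> \<le> (\<Sum>m\<le>T. real m * q m)"
      by (intro sum_mono2) (auto intro!: mult_nonneg_nonneg q0)
    also note moment
    finally have 1: "real (K * N + 1) * R \<le> dp * real N * (\<Sum>m\<le>T. q m)" .
    have S0: "0 \<le> (\<Sum>m\<le>T. q m)" by (intro sum_nonneg q0)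
    have "2 * dp * real N \<le> real K * real N" by (intro mult_right_mono K) auto
    hence "2 * dp * real N \<le> real (K * N + 1)" by simp
    hence "2 * dp * real N * (\<Sum>m\<le>T. q m) \<le> real (K * N + 1) * (\<Sum>m\<le>T. q m)"
      by (rule mult_right_mono) (rule S0)
    with 1 have "real (K * N + 1) * (2 * R) \<le> real (K * N + 1) * (\<Sum>m\<le>T. q m)" by simp
    hence "2 * R \<le> (\<Sum>m\<le>T. q m)" by (rule mult_left_le_imp_le) (rule of_nat_0_less_iff[THEN iffD2], simp)
    thus ?thesis using split by linarith
  qed
  have qD: "q sums D"
  proof -
    have "(\<lambda>m. fps_nth (exp_log_fps (\<lambda>j. complex_of_real (b j))) m * 1 ^ m)
        sums exp (\<Sum>j=1..N. complex_of_real (b j) / of_nat j * 1 ^ j)"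
      by (rule exp_log_fps_polynomial_sums) (simp add: b_def)
    also have "exp (\<Sum>j=1..N. complex_of_real (b j) / of_nat j * 1 ^ j) = complex_of_real D"
      by (simp add: D_def b_def exp_of_real [symmetric])
    finally show ?thesis by (simp add: exp_log_fps_of_real q_def sums_of_real_iff)
  qed
  have "D \<le> 2 * (\<Sum>m\<le>K * N. q m)"
  proof (rule LIMSEQ_le_const2)
    show "(\<lambda>T. \<Sum>m\<le>T. q m) \<longlonglongrightarrow> D" using qD by (simp add: sums_def_le)
  qed (use half in blast)
  also have "(\<Sum>m\<le>K * N. q m) \<le> (\<Sum>m\<le>K * N. p_coeff d m)"
    by (intro sum_mono qp)
  also have "\<dots> \<le> (\<Sum>m<n. p_coeff d m)"
  proof (rule sum_mono2)
    have "K * N \<le> n - 1" by (simp add: N_def)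
    thus "{..K * N} \<subseteq> {..<n}" using n by auto
  qed (auto intro: order.trans[OF q0 qp])
  finally have D_le: "dm / 2 * D \<le> dm * (\<Sum>m<n. p_coeff d m)" using dm by simp
  have "dm * (\<Sum>m<n. p_coeff d m) = dm * (\<Sum>j=1..n. p_coeff d (n - j))"
    by (intro arg_cong[where f = "(*) dm"] sum.reindex_bij_witness[of _ "\<lambda>j. n - j" "\<lambda>m. n - m"]) auto
  also have "\<dots> = (\<Sum>j=1..n. dm * p_coeff d (n - j))" by (rule sum_distrib_left)
  also have "\<dots> \<le> (\<Sum>j=1..n. d j * p_coeff d (n - j))"
    by (intro sum_mono mult_right_mono) (use d order.trans[OF q0 qp] in auto)
  also have "\<dots> = real n * p_coeff d n" by (simp add: p_coeff_def exp_log_fps_recurrence)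
  finally have np: "dm * (\<Sum>m<n. p_coeff d m) \<le> real n * p_coeff d n" .
  have Nn: "N \<le> n" by (simp add: N_def) (metis diff_le_self div_le_dividend order.trans)
  \<comment> \<open>Replacing the full exponent by its truncation costs at most the factor
    \<open>exp (dp * K)\<close>.\<close>
  have "(\<Sum>j=N+1..n. d j / real j) \<le> (\<Sum>j=N+1..n. dp / real (N + 1))"
    by (intro sum_mono frac_le) (use d dm dp in auto)
  also have "\<dots> = dp * (real (n - N) / real (N + 1))" by simp
  also have "\<dots> \<le> dp * real K"
  proof (intro mult_left_mono)
    have "n - 1 < K * (N + 1)"
      using K0 by (simp add: N_def) (metis dividend_less_div_times mult.commute add.commute)
    hence "n - N \<le> K * (N + 1)" using n by linarith
    hence "real (n - N) \<le> real K * real (N + 1)" by (metis of_nat_le_iff of_nat_mult)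
    thus "real (n - N) / real (N + 1) \<le> real K" by (simp add: pos_divide_le_eq)
  qed (use dp in auto)
  finally have tail: "(\<Sum>j=N+1..n. d j / real j) \<le> dp * real K" .
  have "{1..n} = {1..N} \<union> {N+1..n}" using Nn by auto
  hence "(\<Sum>j=1..n. d j / real j) = (\<Sum>j=1..N. d j / real j) + (\<Sum>j=N+1..n. d j / real j)"
    by (simp only:) (rule sum.union_disjoint, auto)
  hence "exp (- dp * real K + (\<Sum>j=1..n. d j / real j)) \<le> D"
    unfolding D_def using tail by (subst exp_le_cancel_iff) simp
  hence "dm / 2 * (exp (- dp * real K) * exp (\<Sum>j=1..n. d j / real j)) \<le> dm / 2 * D"
    using dm by (intro mult_left_mono) (simp_all add: exp_add [symmetric])
  thus ?thesis using D_le np by linarith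
qed

section \<open>The upper bound for \<open>M_coeff\<close>\<close>

text \<open>The logarithm of the target bound \<open>B\<close>, kept as one sum over
  \<open>j\<close> so that different truncations compare termwise. The penalty
  \<open>2 * dp * norm (f j - 1)\<close> reflects \<open>d j \<le> dp\<close> and
  \<open>norm (z ^ j - 1) \<le> 2\<close>.\<close>

definition bound_exponent :: "real \<Rightarrow> (nat \<Rightarrow> real) \<Rightarrow> (nat \<Rightarrow> complex) \<Rightarrow> real \<Rightarrow> nat \<Rightarrow> real" where
  "bound_exponent dp d f u n =
     (\<Sum>j=1..n. (d j * Re (f j) + (if norm (f j - 1) > u then 2 * dp * norm (f j - 1) else 0)) / real j)"

lemma exp_bound_exponent:
  "exp (bound_exponent dp d f u n)
     = exp (\<Sum>j=1..n. d j / real j) * norm (exp (L_one d f n)) * E_fun f n u powr dp"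
proof -
  have "E_fun f n u powr dp
      = exp (dp * (2 * (\<Sum>k | 1 \<le> k \<and> k \<le> n \<and> norm (f k - 1) > u. norm (f k - 1) / real k)))"
    by (simp add: E_fun_def powr_def)
  also have "(\<Sum>k | 1 \<le> k \<and> k \<le> n \<and> norm (f k - 1) > u. norm (f k - 1) / real k)
      = (\<Sum>k=1..n. if norm (f k - 1) > u then norm (f k - 1) / real k else 0)"
    by (intro sum.mono_neutral_cong_left) auto
  also have "norm (exp (L_one d f n)) = exp (\<Sum>j=1..n. d j * (Re (f j) - 1) / real j)"
    by (simp add: L_one_def Re_divide_of_nat)
  ultimately show ?thesis
    by (simp add: bound_exponent_def exp_add [symmetric] sum.distrib [symmetric] sum_distrib_left)
       (intro sum.cong, auto simp: field_simps)
qed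

text \<open>Every numerator is at least \<open>dm / 2\<close>: if
  \<open>norm (f j - 1) \<le> u\<close> then \<open>Re (f j) \<ge> 1/2\<close>, and otherwise the
  penalty outweighs the loss. This growth yields the power saving for truncations shorter than
  \<open>n\<close>.\<close>

lemma bound_exponent_growth:
  assumes d: "\<And>j. 1 \<le> j \<Longrightarrow> dm \<le> d j \<and> d j \<le> dp" and dm: "0 < dm"
    and u: "u \<le> 1/2" and "N \<le> n"
  shows "bound_exponent dp d f u N + dm / 2 * (ln (real n + 1) - ln (real N + 1)) \<le> bound_exponent dp d f u n"
proof -
  define w where "w = (\<lambda>j. d j * Re (f j) + (if norm (f j - 1) > u then 2 * dp * norm (f j - 1) else 0))"
  have W: "bound_exponent dp d f u k = (\<Sum>j=1..k. w j / real j)" for k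
    by (simp add: bound_exponent_def w_def)
  have w: "dm / 2 \<le> w j" if j: "1 \<le> j" for j
  proof -
    define x where "x = norm (f j - 1)"
    have dj: "dm \<le> d j" "d j \<le> dp" using d[OF j] by auto
    have x0: "0 \<le> x" by (simp add: x_def)
    have "1 - Re (f j) \<le> x"
      using complex_Re_le_cmod[of "1 - f j"] by (simp add: x_def norm_minus_commute)
    hence "d j * (1 - x) \<le> d j * Re (f j)" using dj dm by (intro mult_left_mono) auto
    moreover have "d j * (1 - x) \<ge> dm / 2" if "\<not> x > u"
    proof -
      have "dm * (1/2) \<le> d j * (1 - x)"
        by (rule mult_mono) (use that u dj dm in auto)
      thus ?thesis by simp
    qed
    moreover have "d j * (1 - x) + 2 * dp * x \<ge> dm / 2"
    proof -
      have "d j * x \<le> dp * x" "0 \<le> dp * x" using dj dm x0 by (auto intro!: mult_right_mono mult_nonneg_nonneg)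
      thus ?thesis using dj dm by (simp add: algebra_simps)
    qed
    ultimately show ?thesis unfolding w_def x_def [symmetric] by auto
  qed
  have "{1..n} = {1..N} \<union> {N+1..n}" using \<open>N \<le> n\<close> by auto
  hence "(\<Sum>j=1..n. w j / real j) = (\<Sum>j=1..N. w j / real j) + (\<Sum>j=N+1..n. w j / real j)"
    by (simp only:) (rule sum.union_disjoint, auto)
  moreover have "dm / 2 * (ln (real n + 1) - ln (real N + 1)) \<le> dm / 2 * (\<Sum>j=N+1..n. 1 / real j)"
    using dm by (intro mult_left_mono ln_diff_le_sum_inverse \<open>N \<le> n\<close>) auto
  moreover have "\<dots> = (\<Sum>j=N+1..n. dm / 2 / real j)" by (simp add: sum_distrib_left)
  moreover have "\<dots> \<le> (\<Sum>j=N+1..n. w j / real j)"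
    by (intro sum_mono divide_right_mono w) auto
  ultimately show ?thesis unfolding W by linarith
qed

lemma Re_log_M_le_bound_exponent:
  fixes z :: complex
  assumes z: "norm z = 1"
    and d: "\<And>j. 1 \<le> j \<Longrightarrow> dm \<le> d j \<and> d j \<le> dp" and dm: "0 < dm"
    and u: "0 \<le> u" "2 * u * dp \<le> dm"
  shows "Re (\<Sum>j=1..N. complex_of_real (d j) * f j / of_nat j * z ^ j) \<le> bound_exponent dp d f u N + 3 * dm"
proof -
  have *: "Re (complex_of_real (d j) * f j / of_nat j * z ^ j)
      \<le> (d j * Re (f j) + (if norm (f j - 1) > u then 2 * dp * norm (f j - 1) else 0)) / real j
        + d j * (u * norm (z ^ j - 1) - (1 - Re (z ^ j))) / real j" if "j \<in> {1..N}" for j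
  proof -
    define x where "x = norm (f j - 1)"
    define y where "y = norm (z ^ j - 1)"
    have dj: "0 < d j" "d j \<le> dp" using d[of j] dm that by auto
    have y: "0 \<le> y" "y \<le> 2"
      using norm_triangle_ineq4[of "z ^ j" 1] z by (auto simp: norm_power y_def)
    have x: "0 \<le> x" by (simp add: x_def)
    have "Re (f j * z ^ j) = Re (f j) - (1 - Re (z ^ j)) + Re ((f j - 1) * (z ^ j - 1))"
      by (simp add: algebra_simps)
    also have "Re ((f j - 1) * (z ^ j - 1)) \<le> x * y"
      using complex_Re_le_cmod[of "(f j - 1) * (z ^ j - 1)"] by (simp add: norm_mult x_def y_def)
    finally have "d j * Re (f j * z ^ j) \<le> d j * (Re (f j) - (1 - Re (z ^ j)) + x * y)"
      using dj by (intro mult_left_mono) auto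
    \<comment> \<open>For \<open>x > u\<close> the nonnegative term \<open>d j * (u * y)\<close> is
      added anyway, so that the remaining sum runs over all \<open>j\<close> and has the uniform
      bound \<open>3 * dm\<close>.\<close>
    also have "d j * (x * y) \<le> (if x > u then 2 * dp * x else 0) + d j * (u * y)"
    proof (cases "x > u")
      case True
      have "d j * (x * y) \<le> dp * (x * 2)"
        using dj x y by (intro mult_mono) auto
      moreover have "0 \<le> d j * (u * y)" using dj u y by simp
      ultimately show ?thesis using True by simp
    next
      case False
      thus ?thesis using dj y by (auto intro!: mult_left_mono mult_right_mono)
    qed
    hence "d j * (Re (f j) - (1 - Re (z ^ j)) + x * y) \<le>
        (d j * Re (f j) + (if x > u then 2 * dp * x else 0)) + d j * (u * y - (1 - Re (z ^ j)))"
      by (simp add: algebra_simps)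
    finally have "d j * Re (f j * z ^ j) / real j \<le>
        ((d j * Re (f j) + (if x > u then 2 * dp * x else 0)) + d j * (u * y - (1 - Re (z ^ j)))) / real j"
      by (intro divide_right_mono) auto
    moreover have "complex_of_real (d j) * f j / of_nat j * z ^ j = of_real (d j / real j) * (f j * z ^ j)"
      by simp
    hence "Re (complex_of_real (d j) * f j / of_nat j * z ^ j) = d j * Re (f j * z ^ j) / real j"
      by (simp only: times_complex.sel Re_complex_of_real Im_complex_of_real) simp
    ultimately show ?thesis by (simp only: x_def y_def add_divide_distrib)
  qed
  have "Re (\<Sum>j=1..N. complex_of_real (d j) * f j / of_nat j * z ^ j)
      \<le> bound_exponent dp d f u N + (\<Sum>j=1..N. d j * (u * norm (z ^ j - 1) - (1 - Re (z ^ j))) / real j)"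
    unfolding Re_sum bound_exponent_def sum.distrib [symmetric] by (intro sum_mono *)
  also have "(\<Sum>j=1..N. d j * (u * norm (z ^ j - 1) - (1 - Re (z ^ j))) / real j) \<le> 3 * dm"
    by (rule sum_distance_minus_defect_le[OF z d dm u])
  finally show ?thesis by simp
qed

lemma M_coeff_upper_bound:
  fixes d :: "nat \<Rightarrow> real"
  assumes d: "\<And>j. 1 \<le> j \<Longrightarrow> dm \<le> d j \<and> d j \<le> dp" and dm: "0 < dm"
    and f: "\<And>j. 1 \<le> j \<Longrightarrow> norm (f j) \<le> 1"
    and u: "0 \<le> u" "u \<le> 1/2" "2 * u * dp \<le> dm" and n: "1 \<le> n"
  shows "real n * norm (M_coeff d f n)
    \<le> dp * (1 + 2 * dp / (1 - 2 powr -(dm / 2)) * exp (4 * dm)) * exp (bound_exponent dp d f u n)"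
proof -
  define \<delta> where "\<delta> = dm / 2"
  define W where "W = bound_exponent dp d f u"
  define a where "a = (\<lambda>j. complex_of_real (d j) * f j)"
  \<comment> \<open>Normalised so that \<open>Y * N powr \<delta>\<close> equals
    \<open>exp (4 * dm) * exp (W n) * (N / n) powr \<delta>\<close>. Of the \<open>4 * dm\<close>,
    three come from the circle estimate; the fourth covers the loss \<open>\<delta>\<close> in
    \<open>ln (N + 1) \<le> 1 + ln N\<close>.\<close>
  define Y where "Y = exp (4 * dm) * exp (W n) / real n powr \<delta>"
  define C where "C = 2 * dp / (1 - 2 powr -\<delta>)"
  have dp: "0 < dp" using d[of 1] dm by auto
  have a: "norm (a j) \<le> dp" if "1 \<le> j" for j
  proof -
    have "norm (a j) = \<bar>d j\<bar> * norm (f j)" by (simp add: a_def norm_mult)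
    also have "\<dots> \<le> dp * 1" using d[OF that] f[OF that] dm by (intro mult_mono) auto
    finally show ?thesis by simp
  qed
  have bound: "norm (exp (\<Sum>j=1..N. a j / of_nat j * z ^ j)) \<le> Y * real N powr \<delta>"
    if N: "1 \<le> N" "N \<le> n" and z: "norm z = 1" for N z
  proof -
    have "ln (real N + 1) \<le> ln (2 * real N)" using N by simp
    also have "\<dots> = ln 2 + ln (real N)" using N by (simp add: ln_mult)
    also have "ln 2 \<le> (1 :: real)" using ln_add_one_self_le_self[of "1 :: real"] by simp
    finally have "ln (real N + 1) \<le> 1 + ln (real N)" by simp
    moreover have "ln (real n) \<le> ln (real n + 1)" using n by simp
    ultimately have "ln (real n) - ln (real N) - 1 \<le> ln (real n + 1) - ln (real N + 1)"
      by linarith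
    hence "\<delta> * (ln (real n) - ln (real N) - 1) \<le> \<delta> * (ln (real n + 1) - ln (real N + 1))"
      using dm by (intro mult_left_mono) (auto simp: \<delta>_def)
    also have "\<dots> \<le> W n - W N"
      using bound_exponent_growth[where f = f and d = d, OF d dm u(2) N(2)] by (simp add: W_def \<delta>_def)
    finally have "\<delta> * ln (real n) - \<delta> * ln (real N) - \<delta> \<le> W n - W N"
      by (simp only: right_diff_distrib mult_1_right)
    hence "W N + 3 * dm \<le> W n + 4 * dm - \<delta> * ln (real n) + \<delta> * ln (real N)"
      using dm unfolding \<delta>_def by linarith
    moreover have "Re (\<Sum>j=1..N. a j / of_nat j * z ^ j) \<le> W N + 3 * dm"
      unfolding a_def W_def by (rule Re_log_M_le_bound_exponent[OF z d dm u(1,3)])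
    ultimately have "norm (exp (\<Sum>j=1..N. a j / of_nat j * z ^ j))
        \<le> exp (W n + 4 * dm - \<delta> * ln (real n) + \<delta> * ln (real N))"
      by (simp add: norm_exp_eq_Re del: Re_sum)
    also have "\<dots> = Y * real N powr \<delta>"
      using N n by (simp add: Y_def powr_def exp_add exp_diff)
    finally show ?thesis .
  qed
  \<comment> \<open>This absorbs the zeroth coefficient, which the dyadic sum starting at 1
    omits.\<close>
  have W0: "1 \<le> exp (W n)"
  proof -
    have "0 \<le> dm / 2 * (ln (real n + 1) - ln (real 0 + 1))" using dm by simp
    also have "\<dots> \<le> W n"
      using bound_exponent_growth[where f = f and d = d and N = 0 and n = n, OF d dm u(2)] by (simp add: W_def bound_exponent_def)
    finally show ?thesis by simp
  qed
  have "real n * norm (M_coeff d f n) = norm (of_nat n * M_coeff d f n)"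
    by (simp add: norm_mult)
  also have "of_nat n * M_coeff d f n = (\<Sum>j=1..n. a j * fps_nth (exp_log_fps a) (n - j))"
    unfolding M_coeff_def a_def by (rule exp_log_fps_recurrence)
  also have "norm \<dots> \<le> (\<Sum>j=1..n. dp * norm (fps_nth (exp_log_fps a) (n - j)))"
    by (intro sum_norm_le) (simp add: norm_mult a mult_right_mono)
  also have "\<dots> = dp * (\<Sum>m<n. norm (fps_nth (exp_log_fps a) m))"
    unfolding sum_distrib_left [symmetric]
    by (intro arg_cong[where f = "(*) dp"] sum.reindex_bij_witness[of _ "\<lambda>m. n - m" "\<lambda>j. n - j"]) auto
  also have "\<dots> \<le> dp * (1 + (\<Sum>m=1..n. norm (fps_nth (exp_log_fps a) m)))"
  proof (intro mult_left_mono)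
    have "(\<Sum>m<n. norm (fps_nth (exp_log_fps a) m)) \<le> (\<Sum>m=0..n. norm (fps_nth (exp_log_fps a) m))"
      by (intro sum_mono2) auto
    thus "(\<Sum>m<n. norm (fps_nth (exp_log_fps a) m)) \<le> 1 + (\<Sum>m=1..n. norm (fps_nth (exp_log_fps a) m))"
      by (simp add: sum.atLeast_Suc_atMost)
  qed (use dp in auto)
  also have "\<dots> \<le> dp * (exp (W n) + C * (Y * real n powr \<delta>))"
    unfolding C_def
    by (intro mult_left_mono add_mono W0 exp_log_fps_partial_norm_sum_le[where n = n] bound a)
       (use dp dm in \<open>auto simp: Y_def \<delta>_def\<close>)
  also have "Y * real n powr \<delta> = exp (4 * dm) * exp (W n)"
    using n by (simp add: Y_def)
  finally show ?thesis by (simp add: C_def \<delta>_def W_def algebra_simps)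
qed

section \<open>Choice of \<eta> and of the implied constant\<close>

theorem theorem13:
  fixes dm dp :: real
  assumes "0 < dm" and "dm \<le> dp"
  shows "\<exists>\<eta>>0. \<exists>C>0.
    \<forall>(d :: nat \<Rightarrow> real) (f :: nat \<Rightarrow> complex) (n :: nat) (u :: real).
      (\<forall>j\<ge>1. dm \<le> d j \<and> d j \<le> dp) \<longrightarrow>
      (\<forall>j\<ge>1. norm (f j) \<le> 1) \<longrightarrow>
      0 < u \<longrightarrow> u \<le> \<eta> \<longrightarrow>
      norm (M_coeff d f n / complex_of_real (p_coeff d n))
        \<le> C * norm (exp (L_one d f n)) * (E_fun f n u) powr dp"
proof -
  \<comment> \<open>The bound \<open>1/2\<close> serves the growth of \<open>bound_exponent\<close>,
    and \<open>dm / (2 * dp)\<close> gives \<open>2 * u * dp \<le> dm\<close>. \<open>K\<close>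
    meets the Markov condition \<open>2 * dp \<le> K\<close>, and the maximum with 1 in
    \<open>C\<close> settles \<open>n = 0\<close>, where the quotient is 1.\<close>
  define \<eta> where "\<eta> = min (1/2) (dm / (2 * dp))"
  define K where "K = nat \<lceil>2 * dp\<rceil>"
  define c where "c = dm / 2 * exp (- dp * real K)"
  define B where "B = dp * (1 + 2 * dp / (1 - 2 powr -(dm / 2)) * exp (4 * dm))"
  define C where "C = max 1 (B / c)"
  have \<eta>: "0 < \<eta>" using assms by (simp add: \<eta>_def)
  have c: "0 < c" using assms by (simp add: c_def)
  have "norm (M_coeff d f n / complex_of_real (p_coeff d n))
      \<le> C * norm (exp (L_one d f n)) * (E_fun f n u) powr dp"
    if d: "\<forall>j\<ge>1. dm \<le> d j \<and> d j \<le> dp" and f: "\<forall>j\<ge>1. norm (f j) \<le> 1"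
      and u: "0 < u" "u \<le> \<eta>" for d :: "nat \<Rightarrow> real" and f n u
  proof (cases "n = 0")
    case True
    have "{k. k = 0 \<and> 0 < k \<and> u < norm (f k - 1)} = {}" by auto
    thus ?thesis using True
      by (auto simp: M_coeff_def p_coeff_def L_one_def E_fun_def C_def)
  next
    case False
    define D where "D = exp (\<Sum>j=1..n. d j / real j)"
    define X where "X = norm (exp (L_one d f n)) * E_fun f n u powr dp"
    have X: "0 \<le> X" by (simp add: X_def)
    have "u \<le> 1/2" using u by (simp add: \<eta>_def)
    moreover have "u * (2 * dp) \<le> dm"
      using u assms by (simp add: \<eta>_def pos_le_divide_eq)
    ultimately have "real n * norm (M_coeff d f n) \<le> B * exp (bound_exponent dp d f u n)"
      unfolding B_def by (intro M_coeff_upper_bound) (use d f u assms False in \<open>auto simp: mult_ac\<close>)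
    \<comment> \<open>The factor \<open>D\<close> is common to the upper bound for
      \<open>M_coeff\<close> and the lower bound for \<open>p_coeff\<close>, so it cancels in the
      quotient.\<close>
    also have "\<dots> = (B / c) * X * (c * D)"
      using c by (simp add: exp_bound_exponent X_def D_def)
    also have "\<dots> \<le> C * X * (c * D)"
      using X c by (intro mult_right_mono) (auto simp: C_def D_def)
    also have "\<dots> \<le> C * X * (real n * p_coeff d n)"
      unfolding c_def D_def
      by (intro mult_left_mono p_coeff_lower_bound)
         (use d assms False X in \<open>auto simp: K_def C_def intro!: mult_nonneg_nonneg\<close>)
    finally have "norm (M_coeff d f n) \<le> C * X * p_coeff d n"
      using False by (simp add: mult_ac)
    moreover have "0 < p_coeff d n"
    proof -
      have "0 < c * D" using c by (simp add: D_def)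
      also have "\<dots> \<le> real n * p_coeff d n"
        unfolding c_def D_def by (intro p_coeff_lower_bound) (use d assms False in \<open>auto simp: K_def\<close>)
      finally show ?thesis by (simp add: zero_less_mult_iff)
    qed
    ultimately show ?thesis
      by (simp add: norm_divide pos_divide_le_eq X_def mult.assoc)
  qed
  thus ?thesis using \<eta> by (intro exI[of _ \<eta>] conjI exI[of _ C]) (auto simp: C_def)
qed

end
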